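(* Let $\gamma=(m,h)\in\Gamma$ be given. Assume that the density function $f:\mathcal{D}\to\mathbb{R}$ satisfies $$\|f\|_{\mathcal{V}(\rho)}:=\sup_{u\in\mathcal{V}(\rho)}|f(t+u)|<\infty.$$ Let $v_\gamma=\frac1n\,\mathsf{E}\big[\{H_\gamma^\top(0)H_\gamma(X-t)w_h(X-t)\}^2\big]$. Then $$\mathsf{Var}\{\hat f_\gamma(t)\}\le v_\gamma\le v_\gamma^\star,\quad\text{with}\quad v_\gamma^\star=\left(\frac{W_h\sqrt{D_m}}{\lambda_\gamma}\right)^2\times\frac{\|f\|_{\mathcal{V}(\rho)}}{n h^d W_h}.$$
   Context: Setting. Let $d\in\mathbb{N}=\{1,2,\dots\}$ and let $\mathcal{D}$ be the closure of a nonempty open subset of $\mathbb{R}^d$, where $\mathbb{R}^d$ carries the sup norm $\|\cdot\|_\infty$. Fix $t\in\mathcal{D}$, put $\Delta=[-1,1]^d$ and, for $h>0$, $\mathcal{V}(h)=\{u\in\mathbb{R}^d: t+u\in\mathcal{D},\ \|u\|_\infty\le h\}$. Fix $\rho\in(0,e^{-1}]$ such that $\mathcal{V}(\rho)$ is a neighborhood of the origin for the topology on the (translated) domain $\mathcal{D}-t$ inherited from $\mathbb{R}^d$. Let $X,X_1,\dots,X_n$ be i.i.d. random variables supported on $\mathcal{D}$ with density $f$ with respect to Lebesgue measure; $\mathsf{E}$ and $\mathsf{Var}$ are the corresponding expectation and variance. Local polynomial estimator. For $\alpha\in\mathbb{N}_0^d$, $|\alpha|=\sum_j\alpha_j$ and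 $\varphi_\alpha(u)=\prod_{j=1}^d u_j^{\alpha_j}$; $D_m=\binom{m+d}{d}$. $\Gamma=\mathbb{N}_0\times(0,\rho]$. For $\gamma=(m,h)\in\Gamma$: $K=\mathbf{1}_\Delta$, $w_h(u)=h^{-d}K(h^{-1}u)\mathbf{1}_{\mathcal{D}}(t+u)$, $W_h=\int_{\mathbb{R}^d}w_h(u)\,du$; $\Phi_\gamma(u)=(\varphi_\alpha(u/h))_{|\alpha|\le m}$ as a column vector of length $D_m$ (graded by $|\alpha|$, lexicographic order within each degree); $\mathcal{B}_\gamma=\int\Phi_\gamma(u)\Phi_\gamma^\top(u)w_h(u)\,du$ (symmetric positive definite), with smallest eigenvalue $\lambda_\gamma>0$; $\mathcal{B}_\gamma^{1/2}$ is the lower triangular Cholesky factor of $\mathcal{B}_\gamma$; $H_\gamma(u)=\mathcal{B}_\gamma^{-1/2}\Phi_\gamma(u)$. The estimator is $$\hat f_\gamma(t)=\frac1n\sum_{i=1}^n H_\gamma^\top(0)H_\gamma(X_i-t)w_h(X_i-t).$$ *)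

theory Defs
  imports
    "HOL-Probability.Probability"
    "HOL-Library.List_Lexorder"
    "Jordan_Normal_Form.Gauss_Jordan_Elimination"
    "Jordan_Normal_Form.Spectral_Radius"
begin

text \<open>
  Points of \<open>d\<close>-dimensional space are \<open>real ^ 'd\<close>, with \<open>d = CARD('d)\<close>; the order on \<open>'d\<close> is only
  used to order multi-indices. The sup norm is \<^const>\<open>infnorm\<close>. The objects whose size is the
  number \<open>(m + d) choose d\<close> of monomials are the vectors and matrices of \<open>Jordan_Normal_Form\<close>.
  Below, \<open>\<D>\<close> is the domain, \<open>t\<close> the estimation point, and the parameter \<open>\<gamma> = (m, h)\<close> is passed
  as two arguments.
\<close>

(* Both libraries use the infix dollar sign for vector components; here it belongs to
   Jordan_Normal_Form, and components in real ^ 'd are written with vec_nth. *)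
unbundle no vec_syntax

definition nbhd :: "(real ^ 'd) set \<Rightarrow> real ^ 'd \<Rightarrow> real \<Rightarrow> (real ^ 'd) set" where
  "nbhd \<D> t h = {u. t + u \<in> \<D> \<and> infnorm u \<le> h}"

definition sup_norm_nbhd ::
    "(real ^ 'd) set \<Rightarrow> real ^ 'd \<Rightarrow> real \<Rightarrow> (real ^ 'd \<Rightarrow> real) \<Rightarrow> real" where
  "sup_norm_nbhd \<D> t r f = (SUP u\<in>nbhd \<D> t r. \<bar>f (t + u)\<bar>)"

definition unit_cube :: "(real ^ 'd) set" where
  "unit_cube = {u. \<forall>j. vec_nth u j \<in> {-1..1}}"

definition weight :: "(real ^ 'd) set \<Rightarrow> real ^ 'd \<Rightarrow> real \<Rightarrow> real ^ 'd \<Rightarrow> real" where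
  "weight \<D> t h u =
     inverse (h ^ CARD('d)) * indicator unit_cube (u /\<^sub>R h) * indicator \<D> (t + u)"

definition total_weight :: "(real ^ 'd) set \<Rightarrow> real ^ 'd \<Rightarrow> real \<Rightarrow> real" where
  "total_weight \<D> t h = (\<integral>u. weight \<D> t h u \<partial>lborel)"

definition monomial :: "('d \<Rightarrow> nat) \<Rightarrow> real ^ 'd \<Rightarrow> real" where
  "monomial \<alpha> u = (\<Prod>j\<in>UNIV. vec_nth u j ^ \<alpha> j)"

text \<open>
  Comparing the lists \<open>[|\<alpha>|, \<alpha>\<^sub>1, \<dots>, \<alpha>\<^sub>d]\<close> lexicographically is the graded lexicographic order:
  first by degree, then lexicographically (smaller first) within each degree.
\<close>

definition multi_indices :: "nat \<Rightarrow> ('d::{finite,linorder} \<Rightarrow> nat) list" where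
  "multi_indices m =
     sorted_key_list_of_set (\<lambda>\<alpha>. (\<Sum>j\<in>UNIV. \<alpha> j) # map \<alpha> (sorted_list_of_set UNIV))
       {\<alpha>. (\<Sum>j\<in>UNIV. \<alpha> j) \<le> m}"

definition num_monomials :: "'d itself \<Rightarrow> nat \<Rightarrow> nat" where
  "num_monomials _ m = (m + CARD('d)) choose CARD('d)"

definition basis_vec :: "nat \<Rightarrow> real \<Rightarrow> real ^ 'd::{finite,linorder} \<Rightarrow> real vec" where
  "basis_vec m h u =
     vec (num_monomials TYPE('d) m) (\<lambda>k. monomial (multi_indices m ! k) (u /\<^sub>R h))"

definition gram ::
    "(real ^ 'd::{finite,linorder}) set \<Rightarrow> real ^ 'd::_ \<Rightarrow> nat \<Rightarrow> real \<Rightarrow> real mat" where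
  "gram \<D> t m h =
     mat (num_monomials TYPE('d) m) (num_monomials TYPE('d) m)
       (\<lambda>(i, j). \<integral>u. basis_vec m h u $ i * basis_vec m h u $ j * weight \<D> t h u \<partial>lborel)"

definition min_eigenvalue :: "real mat \<Rightarrow> real" where
  "min_eigenvalue A = Min (spectrum A)"

text \<open>The diagonal of the factor is positive, which makes it unique for positive definite \<open>A\<close>.\<close>

definition cholesky :: "real mat \<Rightarrow> real mat" where
  "cholesky A = (THE L. L \<in> carrier_mat (dim_row A) (dim_row A) \<and>
     (\<forall>i<dim_row A. \<forall>j<dim_row A. i < j \<longrightarrow> L $$ (i, j) = 0) \<and>
     (\<forall>i<dim_row A. 0 < L $$ (i, i)) \<and>
     L * transpose_mat L = A)"

definition orth_basis_vec ::
    "(real ^ 'd::{finite,linorder}) set \<Rightarrow> real ^ 'd::_ \<Rightarrow> nat \<Rightarrow> real \<Rightarrow> real ^ 'd::_ \<Rightarrow> real vec" where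
  "orth_basis_vec \<D> t m h u =
     the (mat_inverse (cholesky (gram \<D> t m h))) *\<^sub>v basis_vec m h u"

definition lp_kernel ::
    "(real ^ 'd::{finite,linorder}) set \<Rightarrow> real ^ 'd::_ \<Rightarrow> nat \<Rightarrow> real \<Rightarrow> real ^ 'd::_ \<Rightarrow> real" where
  "lp_kernel \<D> t m h u =
     (orth_basis_vec \<D> t m h 0 \<bullet> orth_basis_vec \<D> t m h u) * weight \<D> t h u"

definition lp_estimator ::
    "(real ^ 'd::{finite,linorder}) set \<Rightarrow> real ^ 'd::_ \<Rightarrow> nat \<Rightarrow> real \<Rightarrow> nat \<Rightarrow> (nat \<Rightarrow> real ^ 'd::_) \<Rightarrow> real"
  where
  "lp_estimator \<D> t m h n x = 1 / real n * (\<Sum>i=1..n. lp_kernel \<D> t m h (x i - t))"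

definition lp_v ::
    "'a measure \<Rightarrow> ('a \<Rightarrow> real ^ 'd::{finite,linorder}) \<Rightarrow> (real ^ 'd::_) set \<Rightarrow> real ^ 'd::_ \<Rightarrow>
      nat \<Rightarrow> real \<Rightarrow> nat \<Rightarrow> real" where
  "lp_v M X \<D> t m h n = 1 / real n * (\<integral>\<omega>. (lp_kernel \<D> t m h (X \<omega> - t))\<^sup>2 \<partial>M)"

definition lp_v_star ::
    "(real ^ 'd::{finite,linorder}) set \<Rightarrow> real ^ 'd::_ \<Rightarrow> real \<Rightarrow> (real ^ 'd::_ \<Rightarrow> real) \<Rightarrow>
      nat \<Rightarrow> real \<Rightarrow> nat \<Rightarrow> real" where
  "lp_v_star \<D> t \<rho> f m h n =
     (total_weight \<D> t h * sqrt (real (num_monomials TYPE('d) m)) /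
        min_eigenvalue (gram \<D> t m h))\<^sup>2 *
     (sup_norm_nbhd \<D> t \<rho> f / (real n * h ^ CARD('d) * total_weight \<D> t h))"

end

theory Submission
  imports Defs
begin

text \<open>
  The estimator is the mean of \<open>n\<close> independent copies of \<open>Y = k (X - t)\<close>, where
  \<open>k u = (H 0 \<bullet> H u) * w u\<close> is the kernel. So its variance is \<open>Var Y / n\<close>, which is at most
  \<open>E[Y\<^sup>2] / n = v\<close>; this is \<open>variance_mean_le\<close>.

  For the second inequality, write \<open>H u = L\<^sup>-\<^sup>1 \<Phi> u\<close> with \<open>L\<close> the Cholesky factor of the Gram matrix \<open>B\<close>,
  and let \<open>\<lambda>\<close> be the smallest eigenvalue of \<open>B\<close>. Since \<open>L\<^sup>-\<^sup>1\<close> has squared operator norm at most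
  \<open>1 / \<lambda>\<close>, the Cauchy-Schwarz inequality gives \<open>(H 0 \<bullet> H u)\<^sup>2 \<le> |\<Phi> 0|\<^sup>2 |\<Phi> u|\<^sup>2 / \<lambda>\<^sup>2\<close>
  (\<open>inverse_cholesky_scalar_prod_bound\<close>). Here \<open>|\<Phi> 0| = 1\<close>, because only the constant monomial
  survives at the origin, and \<open>|\<Phi> u|\<^sup>2\<close> is at most the number \<open>D\<close> of monomials where the weight \<open>w\<close>
  does not vanish. As \<open>w\<close> takes only the values \<open>0\<close> and \<open>h\<^sup>-\<^sup>d\<close>, it follows that
  \<open>k\<^sup>2 \<le> (D / \<lambda>\<^sup>2) h\<^sup>-\<^sup>d w\<close>. On the support of \<open>w\<close> the density is at most its supremum \<open>s\<close> over the
  neighbourhood of radius \<open>\<rho>\<close>, because \<open>h \<le> \<rho>\<close>. Integrating gives \<open>E[Y\<^sup>2] \<le> (D / \<lambda>\<^sup>2) h\<^sup>-\<^sup>d s W\<close> with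
  \<open>W\<close> the integral of \<open>w\<close> (\<open>second_moment_lp_kernel_le\<close>), and this is \<open>n\<close> times the stated bound.

  The remaining work is to see that the objects in these formulas are what they should be: positive
  definite matrices have exactly one Cholesky factor with positive diagonal, their smallest eigenvalue
  is positive and bounds the quadratic form from below (\<open>min_eigenvalue_quadratic_form\<close>), and the Gram
  matrix is positive definite (\<open>pos_def_gram\<close>). The last fact holds because the weight is positive on a
  nonempty open set, \<open>t\<close> being in the closure of an open set, and a nonzero polynomial does not vanish
  identically on a nonempty open set.
\<close>

section \<open>Cholesky factors of positive definite matrices\<close>

(* The bullet is the scalar product of Jordan_Normal_Form throughout. *)
unbundle no inner_syntax

text \<open>Existence is shown for matrices given by their entries, by induction on the size: eliminating the
  first row and column leaves the Schur complement, which is again symmetric and positive definite.\<close>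

lemma cholesky_entries_exist:
  fixes A :: "nat \<Rightarrow> nat \<Rightarrow> real"
  assumes "\<And>i j. i < n \<Longrightarrow> j < n \<Longrightarrow> A i j = A j i"
    and "\<And>v. \<exists>i<n. v i \<noteq> 0 \<Longrightarrow> 0 < (\<Sum>i<n. v i * (\<Sum>j<n. A i j * v j))"
  shows "\<exists>L. (\<forall>i<n. \<forall>j<n. i < j \<longrightarrow> L i j = 0) \<and> (\<forall>i<n. 0 < L i i) \<and>
    (\<forall>i<n. \<forall>j<n. (\<Sum>k<n. L i k * L j k) = A i j)"
  using assms
proof (induction n arbitrary: A)
  case 0
  then show ?case by simp
next
  case (Suc n)
  define a where "a = A 0 0"
  have sym: "A i j = A j i" if "i < Suc n" "j < Suc n" for i j
    using Suc.prems(1) that by blast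
  have pd: "0 < (\<Sum>i<Suc n. v i * (\<Sum>j<Suc n. A i j * v j))" if "\<exists>i<Suc n. v i \<noteq> 0" for v
    using Suc.prems(2) that by blast
  have a: "0 < a"
    using pd[of "\<lambda>i. if i = 0 then 1 else 0"]
    by (auto simp: a_def if_distrib[of "\<lambda>x. _ * x"] if_distribR sum.lessThan_Suc_shift
        simp del: sum.lessThan_Suc)
  define S where "S i j = A (Suc i) (Suc j) - A (Suc i) 0 * A (Suc j) 0 / a" for i j
  have "\<exists>L. (\<forall>i<n. \<forall>j<n. i < j \<longrightarrow> L i j = 0) \<and> (\<forall>i<n. 0 < L i i) \<and>
    (\<forall>i<n. \<forall>j<n. (\<Sum>k<n. L i k * L j k) = S i j)"
  proof (rule Suc.IH)
    show "S i j = S j i" if "i < n" "j < n" for i j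
      using that by (simp add: S_def sym[of "Suc i" "Suc j"])
  next
    fix v :: "nat \<Rightarrow> real"
    assume v: "\<exists>i<n. v i \<noteq> 0"
    define r where "r = (\<Sum>i<n. A (Suc i) 0 * v i)"
    \<comment> \<open>The first entry of \<open>w\<close> minimises the quadratic form of \<open>A\<close> with the other entries given
      by \<open>v\<close>; the minimum is the form of the Schur complement at \<open>v\<close>.\<close>
    define w where "w i = (case i of 0 \<Rightarrow> - r / a | Suc k \<Rightarrow> v k)" for i
    have w: "w 0 = - r / a" "w (Suc i) = v i" for i
      by (simp_all add: w_def)
    from v have "\<exists>i<Suc n. w i \<noteq> 0"
      using w(2) by (metis Suc_mono)
    then have "0 < (\<Sum>i<Suc n. w i * (\<Sum>j<Suc n. A i j * w j))"
      by (rule pd)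
    also have "\<dots> = w 0 * (a * w 0 + (\<Sum>j<n. A 0 (Suc j) * v j)) +
        (\<Sum>i<n. v i * (A (Suc i) 0 * w 0 + (\<Sum>j<n. A (Suc i) (Suc j) * v j)))"
      by (simp add: sum.lessThan_Suc_shift w(2) a_def del: sum.lessThan_Suc)
    also have "(\<Sum>j<n. A 0 (Suc j) * v j) = r"
      unfolding r_def by (intro sum.cong refl) (simp add: sym)
    also have "(\<Sum>i<n. v i * (A (Suc i) 0 * w 0 + (\<Sum>j<n. A (Suc i) (Suc j) * v j))) =
        w 0 * r + (\<Sum>i<n. v i * (\<Sum>j<n. A (Suc i) (Suc j) * v j))"
      by (simp add: r_def distrib_left sum.distrib sum_distrib_left mult_ac)
    also have "(\<Sum>i<n. v i * (\<Sum>j<n. A (Suc i) (Suc j) * v j)) =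
        (\<Sum>i<n. v i * (\<Sum>j<n. S i j * v j)) + r * r / a"
      by (simp add: S_def r_def left_diff_distrib sum_subtractf sum_product sum_divide_distrib
          right_diff_distrib sum_distrib_left mult_ac)
    also have "w 0 * (a * w 0 + r) = 0"
      using a by (simp add: w(1))
    finally show "0 < (\<Sum>i<n. v i * (\<Sum>j<n. S i j * v j))"
      by (simp add: w(1))
  qed
  then obtain L where L: "\<And>i j. i < n \<Longrightarrow> j < n \<Longrightarrow> i < j \<Longrightarrow> L i j = 0"
      "\<And>i. i < n \<Longrightarrow> 0 < L i i"
      "\<And>i j. i < n \<Longrightarrow> j < n \<Longrightarrow> (\<Sum>k<n. L i k * L j k) = S i j"
    by blast
  define R where "R i j = (case i of 0 \<Rightarrow> (if j = 0 then sqrt a else 0)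
    | Suc i' \<Rightarrow> (case j of 0 \<Rightarrow> A i 0 / sqrt a | Suc j' \<Rightarrow> L i' j'))" for i j
  have R: "R 0 j = (if j = 0 then sqrt a else 0)" "R (Suc i) 0 = A (Suc i) 0 / sqrt a"
    "R (Suc i) (Suc k) = L i k" for i j k
    by (simp_all add: R_def)
  have "R i j = 0" if "i < Suc n" "j < Suc n" "i < j" for i j
    using that by (cases i; cases j) (auto simp: R L)
  moreover have "0 < R i i" if "i < Suc n" for i
    using that a by (cases i) (auto simp: R L)
  moreover have "(\<Sum>k<Suc n. R i k * R j k) = A i j" if ij: "i < Suc n" "j < Suc n" for i j
  proof -
    have "(\<Sum>k<Suc n. R i k * R j k) = R i 0 * R j 0 + (\<Sum>k<n. R i (Suc k) * R j (Suc k))"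
      by (rule sum.lessThan_Suc_shift)
    also have "\<dots> = A i j"
    proof (cases i)
      case 0
      then show ?thesis
        using ij a sym[of 0 j] by (cases j) (auto simp: R a_def)
    next
      case (Suc i')
      show ?thesis
      proof (cases j)
        case 0
        then show ?thesis using a by (simp add: R Suc)
      next
        case (Suc j')
        then show ?thesis
          using ij a \<open>i = Suc i'\<close> by (simp add: R L(3) S_def)
      qed
    qed
    finally show ?thesis .
  qed
  ultimately show ?case by blast
qed

text \<open>Symmetric positive definite real matrices of size \<open>n\<close>.\<close>

definition pos_def_mat :: "nat \<Rightarrow> real mat \<Rightarrow> bool" where
  "pos_def_mat n A \<longleftrightarrow> A \<in> carrier_mat n n \<and> transpose_mat A = A \<and>
     (\<forall>v\<in>carrier_vec n. v \<noteq> 0\<^sub>v n \<longrightarrow> 0 < v \<bullet> (A *\<^sub>v v))"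

text \<open>The property that \<^const>\<open>cholesky\<close> selects by a definite description, with the size \<open>n\<close> as
  a parameter: \<open>L\<close> is lower triangular with positive diagonal, and \<open>A = L L\<^sup>T\<close>.\<close>

definition is_cholesky_factor :: "nat \<Rightarrow> real mat \<Rightarrow> real mat \<Rightarrow> bool" where
  "is_cholesky_factor n A L \<longleftrightarrow> L \<in> carrier_mat n n \<and>
     (\<forall>i<n. \<forall>j<n. i < j \<longrightarrow> L $$ (i, j) = 0) \<and> (\<forall>i<n. 0 < L $$ (i, i)) \<and>
     L * transpose_mat L = A"

lemma quadratic_form_sum:
  fixes A :: "'a :: comm_semiring_0 mat"
  assumes "A \<in> carrier_mat n n" "v \<in> carrier_vec n"
  shows "v \<bullet> (A *\<^sub>v v) = (\<Sum>i<n. v $ i * (\<Sum>j<n. A $$ (i, j) * v $ j))"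
  using assms by (auto simp: scalar_prod_def lessThan_atLeast0 intro!: sum.cong)

lemma cholesky_factor_exists:
  assumes "pos_def_mat n A"
  shows "\<exists>L. is_cholesky_factor n A L"
proof -
  have A: "A \<in> carrier_mat n n" and AT: "transpose_mat A = A"
    and pd: "\<And>v. v \<in> carrier_vec n \<Longrightarrow> v \<noteq> 0\<^sub>v n \<Longrightarrow> 0 < v \<bullet> (A *\<^sub>v v)"
    using assms by (auto simp: pos_def_mat_def)
  have "\<exists>L. (\<forall>i<n. \<forall>j<n. i < j \<longrightarrow> L i j = 0) \<and> (\<forall>i<n. 0 < L i i) \<and>
    (\<forall>i<n. \<forall>j<n. (\<Sum>k<n. L i k * L j k) = A $$ (i, j))"
  proof (rule cholesky_entries_exist)
    show "A $$ (i, j) = A $$ (j, i)" if "i < n" "j < n" for i j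
      using AT A that by (metis carrier_matD index_transpose_mat(1))
  next
    fix v :: "nat \<Rightarrow> real"
    assume "\<exists>i<n. v i \<noteq> 0"
    then have "vec n v \<noteq> 0\<^sub>v n"
      by (metis index_vec index_zero_vec(1))
    then have "0 < vec n v \<bullet> (A *\<^sub>v vec n v)"
      by (intro pd) auto
    also have "\<dots> = (\<Sum>i<n. v i * (\<Sum>j<n. A $$ (i, j) * v j))"
      by (simp add: quadratic_form_sum[OF A])
    finally show "0 < (\<Sum>i<n. v i * (\<Sum>j<n. A $$ (i, j) * v j))" .
  qed
  then obtain L where L: "\<And>i j. i < n \<Longrightarrow> j < n \<Longrightarrow> i < j \<Longrightarrow> L i j = 0"
      "\<And>i. i < n \<Longrightarrow> 0 < L i i"
      "\<And>i j. i < n \<Longrightarrow> j < n \<Longrightarrow> (\<Sum>k<n. L i k * L j k) = A $$ (i, j)"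
    by blast
  have "mat n n (\<lambda>(i, j). L i j) * transpose_mat (mat n n (\<lambda>(i, j). L i j)) = A"
    using A by (intro eq_matI) (auto simp: scalar_prod_def L(3)[symmetric] lessThan_atLeast0)
  then show ?thesis
    unfolding is_cholesky_factor_def using L(1,2)
    by (intro exI[of _ "mat n n (\<lambda>(i, j). L i j)"]) auto
qed

text \<open>The column \<open>j\<close> of \<open>L\<close> is determined by the columns before it, since
  \<open>A i j = (\<Sum>k<j. L i k * L j k) + L i j * L j j\<close>, where \<open>i = j\<close> gives the diagonal entry.\<close>

lemma cholesky_factor_unique:
  assumes L: "is_cholesky_factor n A L" and R: "is_cholesky_factor n A R"
  shows "L = R"
proof -
  have dim: "L \<in> carrier_mat n n" "R \<in> carrier_mat n n"
    using L R by (auto simp: is_cholesky_factor_def)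
  have prod: "A $$ (i, j) = (\<Sum>k<j. P $$ (i, k) * P $$ (j, k)) + P $$ (i, j) * P $$ (j, j)"
    if P: "is_cholesky_factor n A P" and ij: "i < n" "j < n" for P i j
  proof -
    have "A $$ (i, j) = (P * transpose_mat P) $$ (i, j)"
      using P by (simp add: is_cholesky_factor_def)
    also have "\<dots> = (\<Sum>k<n. P $$ (i, k) * P $$ (j, k))"
      using P ij by (auto simp: is_cholesky_factor_def scalar_prod_def lessThan_atLeast0)
    also have "\<dots> = (\<Sum>k<Suc j. P $$ (i, k) * P $$ (j, k))"
      using P ij by (intro sum.mono_neutral_right) (auto simp: is_cholesky_factor_def)
    finally show ?thesis by simp
  qed
  have "\<forall>i<n. L $$ (i, j) = R $$ (i, j)" if "j < n" for j
    using that
  proof (induction j rule: less_induct)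
    case (less j)
    have prev: "(\<Sum>k<j. L $$ (i, k) * L $$ (j, k)) = (\<Sum>k<j. R $$ (i, k) * R $$ (j, k))"
      if "i < n" for i
      using less that by (intro sum.cong refl) auto
    have eq: "L $$ (i, j) * L $$ (j, j) = R $$ (i, j) * R $$ (j, j)" if "i < n" for i
      using prod[OF L that less.prems] prod[OF R that less.prems] prev[OF that] by simp
    have pos: "0 < L $$ (j, j)" "0 < R $$ (j, j)"
      using L R less.prems by (auto simp: is_cholesky_factor_def)
    have "(L $$ (j, j))\<^sup>2 = (R $$ (j, j))\<^sup>2"
      using eq[OF less.prems] by (simp add: power2_eq_square)
    then have "L $$ (j, j) = R $$ (j, j)"
      using pos by (simp add: power2_eq_iff_nonneg)
    then show ?case using eq pos by fastforce
  qed
  then show ?thesis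
    using dim by (intro eq_matI) auto
qed

lemma is_cholesky_factor_cholesky:
  assumes "pos_def_mat n A"
  shows "is_cholesky_factor n A (cholesky A)"
proof -
  have n: "dim_row A = n" using assms by (auto simp: pos_def_mat_def)
  have "cholesky A = (THE L. is_cholesky_factor n A L)"
    unfolding cholesky_def is_cholesky_factor_def n ..
  moreover have "\<exists>!L. is_cholesky_factor n A L"
    using cholesky_factor_exists[OF assms] cholesky_factor_unique by blast
  ultimately show ?thesis by (metis theI')
qed

lemma cholesky_factor_inverse:
  assumes "is_cholesky_factor n A L"
  shows "the (mat_inverse L) \<in> carrier_mat n n \<and> L * the (mat_inverse L) = 1\<^sub>m n \<and>
    the (mat_inverse L) * L = 1\<^sub>m n"
proof -
  have L: "L \<in> carrier_mat n n" using assms by (simp add: is_cholesky_factor_def)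
  have "det L = prod_list (diag_mat L)"
    using assms by (intro det_lower_triangular[of n]) (auto simp: is_cholesky_factor_def)
  also have "\<dots> \<noteq> 0"
    using assms by (auto simp: is_cholesky_factor_def prod_list_zero_iff diag_mat_def)
  finally have "L \<in> Units (ring_mat TYPE(real) n ())"
    by (rule det_non_zero_imp_unit[OF L])
  then obtain B where "mat_inverse L = Some B"
    using mat_inverse(1)[OF L, of "()"] by (cases "mat_inverse L") auto
  then show ?thesis using mat_inverse(2)[OF L] by auto
qed

section \<open>The smallest eigenvalue and the inverse Cholesky factor\<close>

lemma scalar_prod_Cauchy_Schwarz:
  fixes v w :: "real vec"
  assumes "v \<in> carrier_vec n" "w \<in> carrier_vec n"
  shows "(v \<bullet> w)\<^sup>2 \<le> (v \<bullet> v) * (w \<bullet> w)"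
  using Cauchy_Schwarz_ineq_sum[of "\<lambda>i. v $ i" "\<lambda>i. w $ i" "{0..<n}"] assms
  by (simp add: scalar_prod_def power2_eq_square)

lemma scalar_prod_self_nonneg: "0 \<le> v \<bullet> (v :: real vec)"
  by (simp add: scalar_prod_def sum_nonneg)

lemma scalar_prod_self_pos:
  assumes "v \<in> carrier_vec n" "v \<noteq> 0\<^sub>v n"
  shows "0 < v \<bullet> (v :: real vec)"
proof -
  obtain i where "i < n" "v $ i \<noteq> 0"
    using assms by (metis carrier_vecD eq_vecI index_zero_vec)
  then show ?thesis using assms(1)
    unfolding scalar_prod_def
    by (intro sum_pos2[of _ i]) (auto simp flip: power2_eq_square)
qed

text \<open>The Rayleigh quotient attains its infimum on the unit sphere. As the dimension is a variable,
  compactness is obtained in the space of sequences with the product topology, where the vectors of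
  size \<open>n\<close> are the sequences that vanish from \<open>n\<close> on.\<close>

lemma quadratic_form_attains_inf:
  fixes A :: "real mat"
  assumes A: "A \<in> carrier_mat n n" and n: "0 < n"
  shows "\<exists>x\<in>carrier_vec n. x \<bullet> x = 1 \<and>
    (\<forall>y\<in>carrier_vec n. (x \<bullet> (A *\<^sub>v x)) * (y \<bullet> y) \<le> y \<bullet> (A *\<^sub>v y))"
proof -
  define Q where "Q x = (\<Sum>i<n. x i * (\<Sum>j<n. A $$ (i, j) * x j))" for x :: "nat \<Rightarrow> real"
  define C where "C = (PiE UNIV (\<lambda>i. if i < n then {-1..1} else {0::real}))"
  define S where "S = C \<inter> {x. (\<Sum>i<n. x i * x i) = 1}"
  have cont: "continuous_on UNIV Q" "continuous_on UNIV (\<lambda>x. \<Sum>i<n. x i * x i :: real)"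
    unfolding Q_def by (intro continuous_intros continuous_on_product_coordinates)+
  have "compactin (product_topology (\<lambda>_. euclidean) UNIV) C"
    unfolding C_def compactin_PiE by auto
  then have "compact C"
    by (simp add: euclidean_product_topology)
  then have "compact S"
    unfolding S_def using closed_Collect_eq[OF cont(2) continuous_on_const]
    by (rule compact_Int_closed)
  moreover have "(\<Sum>i<n. (if i = 0 then 1 else 0) * (if i = 0 then 1 else 0)) = (1::real)"
  proof -
    have "(\<Sum>i<n. (if i = 0 then 1 else 0) * (if i = 0 then 1 else 0)) =
        (\<Sum>i<n. if i = 0 then 1 else (0::real))"
      by (intro sum.cong) auto
    then show ?thesis using n by (simp add: sum.delta)
  qed
  then have "(\<lambda>i. if i = 0 then 1 else 0) \<in> S"
    using n by (auto simp: S_def C_def)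
  then have "S \<noteq> {}" by blast
  ultimately obtain x where x: "x \<in> S" and min: "\<And>y. y \<in> S \<Longrightarrow> Q x \<le> Q y"
    using continuous_attains_inf[of S Q] cont(1) continuous_on_subset by blast
  have Qv: "v \<bullet> (A *\<^sub>v v) = Q (\<lambda>i. v $ i)" if "v \<in> carrier_vec n" for v
    using quadratic_form_sum[OF A that] by (simp add: Q_def)
  have Qx: "vec n x \<bullet> (A *\<^sub>v vec n x) = Q x"
    using Qv[of "vec n x"] by (simp add: Q_def)
  have "Q x * (y \<bullet> y) \<le> y \<bullet> (A *\<^sub>v y)" if y: "y \<in> carrier_vec n" for y
  proof (cases "y = 0\<^sub>v n")
    case True
    then show ?thesis using A by simp
  next
    case False
    define s where "s = y \<bullet> y"
    have s: "0 < s" using scalar_prod_self_pos[OF y False] by (simp add: s_def)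
    define z where "z i = (if i < n then y $ i / sqrt s else 0)" for i
    have "(\<Sum>i<n. z i * z i) = (\<Sum>i<n. y $ i * y $ i) / s"
      using s by (simp add: z_def sum_divide_distrib)
    also have "\<dots> = 1"
      using s y by (simp add: s_def scalar_prod_def lessThan_atLeast0)
    finally have z1: "(\<Sum>i<n. z i * z i) = 1" .
    have "\<bar>z i\<bar> \<le> 1" if "i < n" for i
    proof -
      have "z i * z i \<le> (\<Sum>i<n. z i * z i)"
        using that by (intro member_le_sum) auto
      then show ?thesis unfolding z1 by (simp add: abs_square_le_1 flip: power2_eq_square)
    qed
    then have "-1 \<le> z i \<and> z i \<le> 1" if "i < n" for i
      using that abs_le_iff[of "z i" 1] by fastforce
    moreover have "z i = 0" if "\<not> i < n" for i
      using that by (simp add: z_def)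
    ultimately have "z \<in> S"
      using z1 by (simp add: S_def C_def PiE_iff)
    then have "Q x \<le> Q z" by (rule min)
    also have "Q z = y \<bullet> (A *\<^sub>v y) / s"
      using s unfolding quadratic_form_sum[OF A y]
      by (simp add: Q_def z_def sum_divide_distrib sum_distrib_left sum_distrib_right)
    finally show ?thesis using s by (simp add: s_def field_simps)
  qed
  moreover have "vec n x \<bullet> vec n x = 1"
    using x by (simp add: S_def scalar_prod_def lessThan_atLeast0)
  ultimately show ?thesis
    unfolding Qx[symmetric] by (intro bexI[of _ "vec n x"]) auto
qed

text \<open>If \<open>A - \<mu>\<close> is positive semidefinite, then every zero \<open>x\<close> of its quadratic form lies in its
  kernel: with \<open>g = (A - \<mu>) x\<close>, the form at \<open>x + s g\<close> is \<open>2 s |g|\<^sup>2 + O(s\<^sup>2)\<close>, which is negative for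
  small negative \<open>s\<close> unless \<open>g = 0\<close>.\<close>

lemma minimal_quadratic_form_eigenvector:
  fixes A :: "real mat"
  assumes A: "A \<in> carrier_mat n n" and AT: "transpose_mat A = A"
    and x: "x \<in> carrier_vec n" and \<mu>: "x \<bullet> (A *\<^sub>v x) = \<mu> * (x \<bullet> x)"
    and min: "\<And>y. y \<in> carrier_vec n \<Longrightarrow> \<mu> * (y \<bullet> y) \<le> y \<bullet> (A *\<^sub>v y)"
  shows "A *\<^sub>v x = \<mu> \<cdot>\<^sub>v x"
proof -
  define g where "g = A *\<^sub>v x + (- \<mu>) \<cdot>\<^sub>v x"
  define G where "G = g \<bullet> g"
  define q where "q = g \<bullet> (A *\<^sub>v g) - \<mu> * G"
  have Ax: "A *\<^sub>v x \<in> carrier_vec n" using A x by simp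
  have g: "g \<in> carrier_vec n" using Ax x by (simp add: g_def)
  have Ag: "A *\<^sub>v g \<in> carrier_vec n" using A g by simp
  have "0 \<le> q" using min[OF g] by (simp add: q_def G_def)
  have "0 \<le> G" by (simp add: G_def scalar_prod_self_nonneg)
  have xAg: "x \<bullet> (A *\<^sub>v g) = g \<bullet> (A *\<^sub>v x)"
    using transpose_vec_mult_scalar[OF A g x] AT comm_scalar_prod[OF g Ax] by simp
  have xg: "x \<bullet> g = g \<bullet> x" by (rule comm_scalar_prod[OF x g])
  have "G = g \<bullet> (A *\<^sub>v x) + g \<bullet> ((- \<mu>) \<cdot>\<^sub>v x)"
    unfolding G_def by (subst (2) g_def) (rule scalar_prod_add_distrib[OF g Ax], use x in simp)
  then have gAx: "g \<bullet> (A *\<^sub>v x) = G + \<mu> * (g \<bullet> x)"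
    using g x by simp
  have quad: "0 \<le> 2 * s * G + s\<^sup>2 * q" for s
  proof -
    define y where "y = x + s \<cdot>\<^sub>v g"
    have sg: "s \<cdot>\<^sub>v g \<in> carrier_vec n" and y: "y \<in> carrier_vec n"
      using x g by (auto simp: y_def)
    have Ay: "A *\<^sub>v y = A *\<^sub>v x + s \<cdot>\<^sub>v (A *\<^sub>v g)"
      unfolding y_def using A x g by (simp add: mult_add_distrib_mat_vec mult_mat_vec)
    have yv: "y \<bullet> v = x \<bullet> v + s * (g \<bullet> v)" if "v \<in> carrier_vec n" for v
      unfolding y_def using add_scalar_prod_distrib[OF x sg that] that g by simp
    have vy: "v \<bullet> y = v \<bullet> x + s * (v \<bullet> g)" if "v \<in> carrier_vec n" for v
      unfolding y_def using scalar_prod_add_distrib[OF that x sg] that g by simp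
    have vAy: "v \<bullet> (A *\<^sub>v y) = v \<bullet> (A *\<^sub>v x) + s * (v \<bullet> (A *\<^sub>v g))"
      if "v \<in> carrier_vec n" for v
      unfolding Ay using scalar_prod_add_distrib[OF that Ax, of "s \<cdot>\<^sub>v (A *\<^sub>v g)"] that Ag by simp
    have "0 \<le> y \<bullet> (A *\<^sub>v y) - \<mu> * (y \<bullet> y)" using min[OF y] by simp
    also have "\<dots> = 2 * s * G + s\<^sup>2 * q"
      using A y
      by (simp add: yv vAy[OF x] vAy[OF g] vy[OF x] vy[OF g] \<mu> xAg gAx xg)
        (simp add: q_def G_def algebra_simps power2_eq_square)
    finally show ?thesis .
  qed
  have "G = 0"
  proof (rule ccontr)
    assume "G \<noteq> 0"
    with \<open>0 \<le> G\<close> have "0 < G" by simp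
    define e where "e = G / (q + 1)"
    have "0 < e" and G_eq: "G = e * (q + 1)"
      using \<open>0 < G\<close> \<open>0 \<le> q\<close> by (auto simp: e_def)
    have "0 \<le> 2 * (- e) * G + (- e)\<^sup>2 * q"
      by (rule quad)
    also have "\<dots> = - (e\<^sup>2 * (q + 2))"
      by (simp add: G_eq algebra_simps power2_eq_square)
    also have "\<dots> < 0"
      using \<open>0 < e\<close> \<open>0 \<le> q\<close> by simp
    finally show False by simp
  qed
  then have "g = 0\<^sub>v n"
    using scalar_prod_self_pos[OF g] by (auto simp: G_def)
  then have "(A *\<^sub>v x) $ i = \<mu> * x $ i" if "i < n" for i
    using that Ax x A unfolding g_def
    by (auto dest!: arg_cong[where f="\<lambda>v. v $ i"])
  then show ?thesis
    using A x by (intro eq_vecI) auto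
qed

text \<open>The minimum of the Rayleigh quotient is an eigenvalue. So the spectrum is nonempty, and its least
  element is at most this minimum.\<close>

lemma min_eigenvalue_quadratic_form:
  assumes pd: "pos_def_mat n A" and n: "0 < n"
  shows "0 < min_eigenvalue A"
    and "\<And>y. y \<in> carrier_vec n \<Longrightarrow> min_eigenvalue A * (y \<bullet> y) \<le> y \<bullet> (A *\<^sub>v y)"
proof -
  have A: "A \<in> carrier_mat n n" and AT: "transpose_mat A = A"
    and pos: "\<And>v. v \<in> carrier_vec n \<Longrightarrow> v \<noteq> 0\<^sub>v n \<Longrightarrow> 0 < v \<bullet> (A *\<^sub>v v)"
    using pd by (auto simp: pos_def_mat_def)
  obtain x where x: "x \<in> carrier_vec n" "x \<bullet> x = 1"
    and min: "\<And>y. y \<in> carrier_vec n \<Longrightarrow> (x \<bullet> (A *\<^sub>v x)) * (y \<bullet> y) \<le> y \<bullet> (A *\<^sub>v y)"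
    using quadratic_form_attains_inf[OF A n] by blast
  define \<mu> where "\<mu> = x \<bullet> (A *\<^sub>v x)"
  have "A *\<^sub>v x = \<mu> \<cdot>\<^sub>v x"
    using min x by (intro minimal_quadratic_form_eigenvector[OF A AT]) (auto simp: \<mu>_def)
  moreover have "x \<noteq> 0\<^sub>v n" using x by auto
  ultimately have \<mu>: "\<mu> \<in> spectrum A"
    using A x by (auto simp: spectrum_def eigenvalue_def eigenvector_def)
  have fin: "finite (spectrum A)" by (rule card_finite_spectrum(1)[OF A])
  have "min_eigenvalue A \<in> spectrum A"
    unfolding min_eigenvalue_def using \<mu> fin by (intro Min_in) auto
  then obtain v where v: "v \<in> carrier_vec n" "v \<noteq> 0\<^sub>v n" "A *\<^sub>v v = min_eigenvalue A \<cdot>\<^sub>v v"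
    using A by (auto simp: spectrum_def eigenvalue_def eigenvector_def)
  have "0 < v \<bullet> (A *\<^sub>v v)" using pos v by blast
  also have "\<dots> = min_eigenvalue A * (v \<bullet> v)" using v by simp
  finally show "0 < min_eigenvalue A"
    using scalar_prod_self_nonneg[of v] by (simp add: zero_less_mult_iff)
  show "min_eigenvalue A * (y \<bullet> y) \<le> y \<bullet> (A *\<^sub>v y)" if y: "y \<in> carrier_vec n" for y
  proof -
    have "min_eigenvalue A \<le> \<mu>"
      unfolding min_eigenvalue_def using \<mu> fin by simp
    then have "min_eigenvalue A * (y \<bullet> y) \<le> \<mu> * (y \<bullet> y)"
      by (intro mult_right_mono scalar_prod_self_nonneg)
    then show ?thesis using min[OF y] by (simp add: \<mu>_def)
  qed
qed

text \<open>Let \<open>\<lambda>\<close> be the smallest eigenvalue. With \<open>y = L\<^sup>-\<^sup>T r\<close>, the equation \<open>L r = q\<close> becomes \<open>A y = q\<close>, and \<open>|r|\<^sup>2 = y \<bullet> q = y \<bullet> A y\<close> is at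
  least \<open>\<lambda> |y|\<^sup>2\<close>. The Cauchy-Schwarz inequality for \<open>y \<bullet> q\<close> then bounds \<open>|r|\<^sup>2\<close>.\<close>

lemma inverse_cholesky_norm_bound:
  fixes A :: "real mat"
  assumes pd: "pos_def_mat n A" and n: "0 < n" and q: "q \<in> carrier_vec n"
  defines "r \<equiv> the (mat_inverse (cholesky A)) *\<^sub>v q"
  shows "r \<bullet> r \<le> (q \<bullet> q) / min_eigenvalue A"
proof -
  define L where "L = cholesky A"
  define B where "B = the (mat_inverse L)"
  define y where "y = transpose_mat B *\<^sub>v r"
  define l where "l = min_eigenvalue A"
  have fac: "is_cholesky_factor n A L"
    unfolding L_def by (rule is_cholesky_factor_cholesky[OF pd])
  have L: "L \<in> carrier_mat n n" and LL: "L * transpose_mat L = A"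
    using fac by (auto simp: is_cholesky_factor_def)
  have B: "B \<in> carrier_mat n n" and LB: "L * B = 1\<^sub>m n" and BL: "B * L = 1\<^sub>m n"
    using cholesky_factor_inverse[OF fac] by (auto simp: B_def)
  have r_def': "r = B *\<^sub>v q" by (simp add: r_def B_def L_def)
  have r: "r \<in> carrier_vec n" using B q by (simp add: r_def')
  have y: "y \<in> carrier_vec n" using B r by (simp add: y_def)
  have Lr: "L *\<^sub>v r = q"
    unfolding r_def' using L B q LB by (simp flip: assoc_mult_mat_vec)
  have "transpose_mat L *\<^sub>v y = transpose_mat (B * L) *\<^sub>v r"
    unfolding y_def using L B r by (simp add: transpose_mult[of B n n L n])
  also have "\<dots> = r" using r by (simp add: BL)
  finally have "A *\<^sub>v y = q"
    unfolding LL[symmetric] using L y Lr by (simp add: assoc_mult_mat_vec[of L n n])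
  moreover have yq: "y \<bullet> q = r \<bullet> r"
    unfolding y_def using transpose_vec_mult_scalar[OF B q r] by (simp add: r_def')
  ultimately have ly: "l * (y \<bullet> y) \<le> r \<bullet> r"
    using min_eigenvalue_quadratic_form(2)[OF pd n y] by (simp add: l_def)
  have l: "0 < l" using min_eigenvalue_quadratic_form(1)[OF pd n] by (simp add: l_def)
  have "l * (r \<bullet> r)\<^sup>2 \<le> l * ((y \<bullet> y) * (q \<bullet> q))"
    using scalar_prod_Cauchy_Schwarz[OF y q] l by (simp add: yq)
  also have "\<dots> \<le> (r \<bullet> r) * (q \<bullet> q)"
    using mult_right_mono[OF ly scalar_prod_self_nonneg[of q]] by (simp add: mult_ac)
  finally have "(r \<bullet> r) * (l * (r \<bullet> r)) \<le> (r \<bullet> r) * (q \<bullet> q)"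
    by (simp add: power2_eq_square mult_ac)
  then have "l * (r \<bullet> r) \<le> q \<bullet> q"
    using scalar_prod_self_nonneg[of r] scalar_prod_self_nonneg[of q] l
    by (cases "r \<bullet> r = 0") auto
  then show ?thesis using l by (simp add: l_def field_simps)
qed

lemma inverse_cholesky_scalar_prod_bound:
  fixes A :: "real mat"
  assumes pd: "pos_def_mat n A" and n: "0 < n" and p: "p \<in> carrier_vec n" and q: "q \<in> carrier_vec n"
  defines "B \<equiv> the (mat_inverse (cholesky A))"
  shows "((B *\<^sub>v p) \<bullet> (B *\<^sub>v q))\<^sup>2 \<le> (p \<bullet> p) * (q \<bullet> q) / (min_eigenvalue A)\<^sup>2"
proof -
  have B: "B \<in> carrier_mat n n"
    using cholesky_factor_inverse[OF is_cholesky_factor_cholesky[OF pd]] by (simp add: B_def)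
  have "((B *\<^sub>v p) \<bullet> (B *\<^sub>v q))\<^sup>2 \<le> ((B *\<^sub>v p) \<bullet> (B *\<^sub>v p)) * ((B *\<^sub>v q) \<bullet> (B *\<^sub>v q))"
    using B p q by (intro scalar_prod_Cauchy_Schwarz[of _ n]) auto
  also have "\<dots> \<le> ((p \<bullet> p) / min_eigenvalue A) * ((q \<bullet> q) / min_eigenvalue A)"
    unfolding B_def using min_eigenvalue_quadratic_form(1)[OF pd n]
    by (intro mult_mono inverse_cholesky_norm_bound[OF pd n] p q scalar_prod_self_nonneg
        divide_nonneg_pos)
  finally show ?thesis by (simp add: power2_eq_square)
qed

section \<open>Multi-indices and monomials\<close>

lemma (in linorder) sorted_key_list_of_set_inj:
  assumes "inj f" "finite A"
  shows "set (sorted_key_list_of_set f A) = A" and "distinct (sorted_key_list_of_set f A)"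
    and "length (sorted_key_list_of_set f A) = card A"
proof -
  interpret k: folding_insort_key "(\<le>)" "(<)" UNIV f
    by unfold_locales (rule assms(1))
  show "set (sorted_key_list_of_set f A) = A"
    using assms(2) by (rule k.set_sorted_key_list_of_set[OF subset_UNIV])
  show "distinct (sorted_key_list_of_set f A)"
    using k.distinct_sorted_key_list_of_set[of A] by (simp add: distinct_map)
  show "length (sorted_key_list_of_set f A) = card A"
    by (rule k.length_sorted_key_list_of_set[OF subset_UNIV])
qed

text \<open>The multi-indices of degree at most \<open>m\<close> are counted by adding the slack \<open>m - |\<alpha>|\<close> as a further
  entry, which gives the lists of length \<open>d + 1\<close> with sum \<open>m\<close>.\<close>

lemma multi_indices_enumerate:
  fixes m :: nat
  defines "A \<equiv> {\<alpha> :: 'd::{finite,linorder} \<Rightarrow> nat. (\<Sum>j\<in>UNIV. \<alpha> j) \<le> m}"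
  shows "finite A" and "card A = num_monomials TYPE('d) m"
    and "set (multi_indices m) = A" and "distinct (multi_indices m :: ('d \<Rightarrow> nat) list)"
    and "length (multi_indices m :: ('d \<Rightarrow> nat) list) = num_monomials TYPE('d) m"
proof -
  define xs where "xs = sorted_list_of_set (UNIV :: 'd set)"
  have xs: "set xs = UNIV" "distinct xs" "length xs = CARD('d)"
    by (simp_all add: xs_def)
  have map_inj: "\<alpha> = \<beta>" if "map \<alpha> xs = map \<beta> xs" for \<alpha> \<beta> :: "'d \<Rightarrow> nat"
    using that xs(1) by (metis UNIV_I ext map_eq_conv)
  have sum_map: "sum_list (map \<alpha> xs) = (\<Sum>j\<in>UNIV. \<alpha> j)" for \<alpha> :: "'d \<Rightarrow> nat"
    using xs by (simp add: sum_list_distinct_conv_sum_set)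
  define B where "B = {l :: nat list. length l = CARD('d) + 1 \<and> sum_list l = m}"
  define \<phi> where "\<phi> \<alpha> = (m - (\<Sum>j\<in>UNIV. \<alpha> j)) # map \<alpha> xs" for \<alpha>
  have "inj_on \<phi> A"
    using map_inj by (intro inj_onI) (simp add: \<phi>_def del: map_eq_conv)
  moreover have "\<phi> ` A = B"
  proof
    show "\<phi> ` A \<subseteq> B"
      by (auto simp: A_def B_def \<phi>_def sum_map xs(3))
    show "B \<subseteq> \<phi> ` A"
    proof
      fix l assume "l \<in> B"
      then obtain a l' where l: "l = a # l'" "length l' = CARD('d)" "a + sum_list l' = m"
        by (cases l) (auto simp: B_def)
      define \<alpha> where "\<alpha> j = the (map_of (zip xs l') j)" for j
      have "map \<alpha> xs = l'"
        using l(2) xs by (intro nth_equalityI) (auto simp: \<alpha>_def map_of_zip_nth)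
      then have "(\<Sum>j\<in>UNIV. \<alpha> j) = sum_list l'"
        using sum_map[of \<alpha>] by simp
      then show "l \<in> \<phi> ` A"
        using l \<open>map \<alpha> xs = l'\<close> by (intro image_eqI[of _ _ \<alpha>]) (auto simp: \<phi>_def A_def)
    qed
  qed
  ultimately have "bij_betw \<phi> A B" by (simp add: bij_betw_def)
  have "card B = (m + CARD('d)) choose m"
    unfolding B_def by (subst card_length_sum_list) simp
  also have "\<dots> = num_monomials TYPE('d) m"
    unfolding num_monomials_def by (subst binomial_symmetric) auto
  finally have cardB: "card B = num_monomials TYPE('d) m" .
  with \<open>bij_betw \<phi> A B\<close> show cardA: "card A = num_monomials TYPE('d) m"
    by (simp add: bij_betw_same_card)
  then show "finite A"
    by (rule_tac card_ge_0_finite) (simp add: num_monomials_def)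
  define key where "key \<alpha> = (\<Sum>j\<in>UNIV. \<alpha> j) # map \<alpha> xs" for \<alpha> :: "'d \<Rightarrow> nat"
  have "inj key"
    using map_inj by (intro injI) (simp add: key_def del: map_eq_conv)
  note k = sorted_key_list_of_set_inj[OF this \<open>finite A\<close>]
  have mi: "multi_indices m = sorted_key_list_of_set key A"
    unfolding multi_indices_def key_def xs_def A_def ..
  show "set (multi_indices m) = A" and "distinct (multi_indices m :: ('d \<Rightarrow> nat) list)"
    and "length (multi_indices m :: ('d \<Rightarrow> nat) list) = num_monomials TYPE('d) m"
    unfolding mi cardA[symmetric] by (fact k)+
qed

lemma num_monomials_pos: "0 < num_monomials TYPE('d::finite) m"
  by (simp add: num_monomials_def)

text \<open>A polynomial that vanishes on a product of infinite sets \<open>S j\<close> has only zero coefficients. The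
  induction on the set \<open>J\<close> of variables collects the terms by the power of one variable, so the
  hypothesis on \<open>A\<close> is that exponents are determined by their values on \<open>J\<close>.\<close>

lemma polynomial_coefficients_zero:
  fixes c :: "('a \<Rightarrow> nat) \<Rightarrow> real"
  assumes "finite J" and "\<And>j. j \<in> J \<Longrightarrow> infinite (S j)" and "finite A"
    and "\<And>\<alpha> \<beta>. \<alpha> \<in> A \<Longrightarrow> \<beta> \<in> A \<Longrightarrow> (\<forall>j\<in>J. \<alpha> j = \<beta> j) \<Longrightarrow> \<alpha> = \<beta>"
    and "\<And>u. (\<forall>j\<in>J. u j \<in> S j) \<Longrightarrow> (\<Sum>\<alpha>\<in>A. c \<alpha> * (\<Prod>j\<in>J. u j ^ \<alpha> j)) = 0"
    and "\<alpha> \<in> A"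
  shows "c \<alpha> = 0"
  using assms
proof (induction J arbitrary: A \<alpha> rule: finite_induct)
  case empty
  have "A = {\<alpha>}" using empty by auto
  then show ?case using empty.prems(4) by simp
next
  case (insert j J)
  define A' where "A' = {\<beta> \<in> A. \<beta> j = \<alpha> j}"
  show ?case
  proof (rule insert.IH)
    show "infinite (S i)" if "i \<in> J" for i using insert.prems(1) that by simp
    show "finite A'" using insert.prems(2) by (simp add: A'_def)
    show "\<alpha> \<in> A'" using insert.prems(5) by (simp add: A'_def)
    show "\<beta> = \<gamma>" if "\<beta> \<in> A'" "\<gamma> \<in> A'" "\<forall>i\<in>J. \<beta> i = \<gamma> i" for \<beta> \<gamma>
      using that by (intro insert.prems(3)) (auto simp: A'_def)
  next
    fix u :: "'a \<Rightarrow> real"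
    assume u: "\<forall>i\<in>J. u i \<in> S i"
    \<comment> \<open>\<open>p k\<close> is the coefficient of the \<open>k\<close>-th power of the variable \<open>j\<close>, at the point \<open>u\<close>.\<close>
    define p where "p k = (\<Sum>\<beta> | \<beta> \<in> A \<and> \<beta> j = k. c \<beta> * (\<Prod>i\<in>J. u i ^ \<beta> i))" for k
    define N where "N = Max ((\<lambda>\<beta>. \<beta> j) ` A)"
    have N: "\<beta> j \<le> N" if "\<beta> \<in> A" for \<beta>
      unfolding N_def using that insert.prems(2) by auto
    have "(\<Sum>k\<le>N. p k * x ^ k) = 0" if x: "x \<in> S j" for x
    proof -
      have prod: "(\<Prod>i\<in>insert j J. (u(j := x)) i ^ \<beta> i) = x ^ \<beta> j * (\<Prod>i\<in>J. u i ^ \<beta> i)" for \<beta>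
      proof -
        have "(\<Prod>i\<in>J. (u(j := x)) i ^ \<beta> i) = (\<Prod>i\<in>J. u i ^ \<beta> i)"
          using insert.hyps(2) by (intro prod.cong) auto
        then show ?thesis using insert.hyps by simp
      qed
      have "0 = (\<Sum>\<beta>\<in>A. c \<beta> * (\<Prod>i\<in>insert j J. (u(j := x)) i ^ \<beta> i))"
        using u x by (intro insert.prems(4)[symmetric]) auto
      also have "\<dots> = (\<Sum>\<beta>\<in>A. c \<beta> * (\<Prod>i\<in>J. u i ^ \<beta> i) * x ^ \<beta> j)"
        by (simp only: prod mult_ac)
      also have "\<dots> = (\<Sum>k\<le>N. \<Sum>\<beta> | \<beta> \<in> A \<and> \<beta> j = k. c \<beta> * (\<Prod>i\<in>J. u i ^ \<beta> i) * x ^ \<beta> j)"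
        using insert.prems(2) N by (intro sum.group[symmetric]) auto
      also have "\<dots> = (\<Sum>k\<le>N. p k * x ^ k)"
        by (simp add: p_def sum_distrib_right)
      finally show ?thesis by simp
    qed
    then have "S j \<subseteq> {x. (\<Sum>k\<le>N. p k * x ^ k) = 0}" by blast
    then have "infinite {x. (\<Sum>k\<le>N. p k * x ^ k) = 0}"
      using insert.prems(1)[of j] finite_subset by blast
    then have "p (\<alpha> j) = 0"
      using N[OF insert.prems(5)] polyfun_finite_roots[of p N] by blast
    then show "(\<Sum>\<beta>\<in>A'. c \<beta> * (\<Prod>i\<in>J. u i ^ \<beta> i)) = 0"
      by (simp add: p_def A'_def)
  qed
qed

lemma continuous_on_basis_vec:
  assumes "k < num_monomials TYPE('d::{finite,linorder}) m"
  shows "continuous_on UNIV (\<lambda>u :: real ^ 'd::_. basis_vec m h u $ k)"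
  using assms unfolding basis_vec_def monomial_def
  by (auto intro!: continuous_intros)

lemma dim_basis_vec [simp]:
  "basis_vec m h (u :: real ^ 'd::{finite,linorder}) \<in> carrier_vec (num_monomials TYPE('d) m)"
  by (simp add: basis_vec_def)

lemma sum_multi_indices:
  fixes F :: "('d::{finite,linorder} \<Rightarrow> nat) \<Rightarrow> 'a::comm_monoid_add"
  shows "(\<Sum>k<num_monomials TYPE('d) m. F (multi_indices m ! k)) =
    (\<Sum>\<alpha> | (\<Sum>j\<in>UNIV. \<alpha> j) \<le> m. F \<alpha>)"
proof (rule sum.reindex_bij_betw)
  show "bij_betw (\<lambda>k. multi_indices m ! k) {..<num_monomials TYPE('d) m}
      {\<alpha> :: 'd \<Rightarrow> nat. (\<Sum>j\<in>UNIV. \<alpha> j) \<le> m}"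
    using multi_indices_enumerate(3-5)[where 'd='d and m=m] by (intro bij_betw_nth) auto
qed

lemma basis_vec_0_norm:
  "basis_vec m h (0 :: real ^ 'd::{finite,linorder}) \<bullet> basis_vec m h (0 :: real ^ 'd::_) = 1"
proof -
  have mono: "monomial \<alpha> (0 :: real ^ 'd::_) = (if \<alpha> = (\<lambda>_. 0) then 1 else 0)" for \<alpha>
    by (auto simp: monomial_def fun_eq_iff)
  have "basis_vec m h (0 :: real ^ 'd::_) \<bullet> basis_vec m h (0 :: real ^ 'd::_) =
      (\<Sum>k<num_monomials TYPE('d) m. monomial (multi_indices m ! k) (0 :: real ^ 'd::_) *
        monomial (multi_indices m ! k) (0 :: real ^ 'd::_))"
    by (simp add: basis_vec_def scalar_prod_def lessThan_atLeast0)
  also have "\<dots> = (\<Sum>\<alpha> | (\<Sum>j\<in>UNIV. \<alpha> j) \<le> m. monomial \<alpha> (0 :: real ^ 'd::_) * monomial \<alpha> (0 :: real ^ 'd::_))"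
    by (rule sum_multi_indices)
  also have "\<dots> = (\<Sum>\<alpha> :: 'd \<Rightarrow> nat | (\<Sum>j\<in>UNIV. \<alpha> j) \<le> m. if \<alpha> = (\<lambda>_. 0) then 1 else 0)"
    by (intro sum.cong) (auto simp: mono)
  also have "\<dots> = 1"
    using multi_indices_enumerate(1)[where 'd='d and m=m] by (simp add: sum.delta)
  finally show ?thesis .
qed

lemma basis_vec_norm_le:
  fixes u :: "real ^ 'd::{finite,linorder}"
  assumes "0 < h" and "\<And>j. \<bar>vec_nth u j\<bar> \<le> h"
  shows "basis_vec m h u \<bullet> basis_vec m h u \<le> num_monomials TYPE('d) m"
proof -
  have "\<bar>monomial \<alpha> (u /\<^sub>R h)\<bar> \<le> 1" for \<alpha>
  proof -
    have "\<bar>vec_nth u j / h\<bar> \<le> 1" for j using assms by (simp add: abs_divide)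
    then show ?thesis
      unfolding monomial_def abs_prod
      by (intro prod_le_1) (auto simp: power_abs divide_inverse mult.commute intro!: power_le_one)
  qed
  then have "(monomial \<alpha> (u /\<^sub>R h))\<^sup>2 \<le> 1" for \<alpha>
    by (simp add: abs_square_le_1)
  then have "(\<Sum>k<num_monomials TYPE('d) m. (monomial (multi_indices m ! k) (u /\<^sub>R h))\<^sup>2) \<le>
      (\<Sum>k<num_monomials TYPE('d) m. 1)"
    by (intro sum_mono)
  then show ?thesis
    by (simp add: basis_vec_def scalar_prod_def lessThan_atLeast0 power2_eq_square)
qed

text \<open>The open set contains a box, on which \<open>polynomial_coefficients_zero\<close> applies after scaling by
  \<open>h\<close>.\<close>

lemma monomials_independent:
  fixes W :: "(real ^ 'd::{finite,linorder}) set" and v :: "real vec"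
  assumes h: "0 < h" and W: "open W" "W \<noteq> {}"
    and v: "v \<in> carrier_vec (num_monomials TYPE('d) m)"
    and zero: "\<And>u. u \<in> W \<Longrightarrow> v \<bullet> basis_vec m h u = 0"
  shows "v = 0\<^sub>v (num_monomials TYPE('d) m)"
proof -
  define N where "N = num_monomials TYPE('d) m"
  define idx where "idx = (\<lambda>k. multi_indices m ! k :: 'd \<Rightarrow> nat)"
  have inj: "inj_on idx {..<N}"
    unfolding idx_def N_def using multi_indices_enumerate(4,5)[where 'd='d and m=m]
    by (intro inj_on_nth) auto
  \<comment> \<open>\<open>c \<alpha>\<close> is the coefficient of the monomial \<open>\<alpha>\<close> in \<open>v \<bullet> basis_vec m h\<close>.\<close>
  define c where "c \<alpha> = v $ inv_into {..<N} idx \<alpha>" for \<alpha>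
  have c: "c (idx k) = v $ k" if "k < N" for k
    using that inj by (simp add: c_def inv_into_f_f)
  obtain p where "p \<in> W" using W(2) by blast
  then obtain I where I: "\<And>i. open (I i)" "\<And>i. vec_nth p i \<in> I i"
    and box: "\<And>y. (\<forall>i. vec_nth y i \<in> I i) \<Longrightarrow> y \<in> W"
    using W(1) unfolding open_vec_def by metis
  have inf: "infinite ((\<lambda>x. x / h) ` I j)" for j
  proof -
    have "infinite (I j)"
      using I[of j] finite_imp_not_open by blast
    moreover have "inj_on (\<lambda>x. x / h) (I j)"
      using h by (intro inj_onI) simp
    ultimately show ?thesis by (simp add: finite_image_iff)
  qed
  have "c \<alpha> = 0" if "\<alpha> \<in> {\<alpha>. (\<Sum>j\<in>UNIV. \<alpha> j) \<le> m}" for \<alpha> :: "'d \<Rightarrow> nat"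
  proof (rule polynomial_coefficients_zero[where J = UNIV and S = "\<lambda>j. (\<lambda>x. x / h) ` I j"])
    show "finite {\<alpha> :: 'd \<Rightarrow> nat. (\<Sum>j\<in>UNIV. \<alpha> j) \<le> m}"
      by (rule multi_indices_enumerate(1))
    fix x :: "'d \<Rightarrow> real"
    assume x: "\<forall>j\<in>UNIV. x j \<in> (\<lambda>x. x / h) ` I j"
    define u :: "real ^ 'd::_" where "u = vec_lambda (\<lambda>j. h * x j)"
    have "h * x j \<in> I j" for j
    proof -
      obtain y where "y \<in> I j" "x j = y / h" using x by blast
      then show ?thesis using h by simp
    qed
    then have "u \<in> W"
      by (intro box) (simp add: u_def)
    have "u /\<^sub>R h = vec_lambda x"
      using h by (simp add: u_def Finite_Cartesian_Product.vec_eq_iff)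
    then have "(\<Sum>k<N. c (idx k) * (\<Prod>j\<in>UNIV. x j ^ idx k j)) = v \<bullet> basis_vec m h u"
      by (simp add: basis_vec_def scalar_prod_def lessThan_atLeast0 monomial_def N_def[symmetric] c
          flip: idx_def)
    also have "\<dots> = 0" by (rule zero[OF \<open>u \<in> W\<close>])
    finally show "(\<Sum>\<alpha> | (\<Sum>j\<in>UNIV. \<alpha> j) \<le> m. c \<alpha> * (\<Prod>j\<in>UNIV. x j ^ \<alpha> j)) = 0"
      unfolding N_def idx_def by (subst (asm) sum_multi_indices)
  qed (use inf that in auto)
  moreover have "idx k \<in> {\<alpha>. (\<Sum>j\<in>UNIV. \<alpha> j) \<le> m}" if "k < N" for k
    using that multi_indices_enumerate(3,5)[where 'd='d and m=m] unfolding idx_def N_def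
    by (metis nth_mem)
  ultimately have "v $ k = 0" if "k < N" for k
    using c[OF that] that by metis
  then show ?thesis
    using v by (intro eq_vecI) (auto simp: N_def)
qed

section \<open>The weight and the Gram matrix\<close>

text \<open>The set on which the weight does not vanish when \<open>h > 0\<close>: the part of the cube \<open>[-h, h]\<^sup>d\<close> that
  \<open>t\<close> translates into \<open>\<D>\<close>.\<close>

definition weight_support :: "(real ^ 'd) set \<Rightarrow> real ^ 'd \<Rightarrow> real \<Rightarrow> (real ^ 'd) set" where
  "weight_support \<D> t h = {u. (\<forall>j. \<bar>vec_nth u j\<bar> \<le> h) \<and> t + u \<in> \<D>}"

lemma weight_eq_indicator:
  assumes "0 < h"
  shows "weight \<D> t h u = inverse (h ^ CARD('d)) * indicator (weight_support \<D> t h) (u :: real ^ 'd)"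
proof -
  have "inverse h * x \<in> {-1..1} \<longleftrightarrow> \<bar>x\<bar> \<le> h" for x
    using assms by (auto simp: field_simps abs_le_iff)
  then show ?thesis
    by (simp add: weight_def weight_support_def unit_cube_def indicator_def)
qed

lemma compact_weight_support:
  assumes "closed \<D>"
  shows "compact (weight_support \<D> t h)"
proof -
  have "weight_support \<D> t h =
      cbox (vec_lambda (\<lambda>_. - h)) (vec_lambda (\<lambda>_. h)) \<inter> (\<lambda>u. t + u) -` \<D>"
    by (auto simp: weight_support_def mem_box_cart abs_le_iff minus_le_iff)
  moreover have "closed ((\<lambda>u. t + u) -` \<D>)"
    by (intro closed_vimage assms continuous_intros)
  ultimately show ?thesis by (simp add: compact_Int_closed)
qed

lemma integrable_mult_weight:
  fixes g :: "real ^ 'd \<Rightarrow> real"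
  assumes "closed \<D>" "0 < h" "continuous_on UNIV g"
  shows "integrable lborel (\<lambda>u. g u * weight \<D> t h u)"
proof -
  have "integrable lborel (\<lambda>u. indicator (weight_support \<D> t h) u *\<^sub>R g u)"
    using assms by (intro borel_integrable_compact compact_weight_support)
      (auto intro: continuous_on_subset)
  then have "integrable lborel
      (\<lambda>u. inverse (h ^ CARD('d)) * (indicator (weight_support \<D> t h) u *\<^sub>R g u))"
    by (rule integrable_mult_right)
  then show ?thesis
    by (simp add: weight_eq_indicator[OF assms(2)] mult_ac)
qed

lemma gram_quadratic_form:
  fixes \<D> :: "(real ^ 'd::{finite,linorder}) set"
  assumes "closed \<D>" "0 < h" and v: "v \<in> carrier_vec (num_monomials TYPE('d) m)"
  shows "integrable lborel (\<lambda>u. (v \<bullet> basis_vec m h u)\<^sup>2 * weight \<D> t h u)"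
    and "v \<bullet> (gram \<D> t m h *\<^sub>v v) = (\<integral>u. (v \<bullet> basis_vec m h u)\<^sup>2 * weight \<D> t h u \<partial>lborel)"
proof -
  define N where "N = num_monomials TYPE('d) m"
  have v_basis: "v \<bullet> basis_vec m h u = (\<Sum>k<N. v $ k * basis_vec m h u $ k)" for u :: "real ^ 'd::_"
    by (simp add: scalar_prod_def basis_vec_def lessThan_atLeast0 N_def)
  have int: "integrable lborel (\<lambda>u. basis_vec m h u $ i * basis_vec m h u $ j * weight \<D> t h u)"
    if "i < N" "j < N" for i j
    using that assms(1,2)
    by (intro integrable_mult_weight continuous_on_mult continuous_on_basis_vec) (auto simp: N_def)
  have sq: "(v \<bullet> basis_vec m h u)\<^sup>2 * weight \<D> t h u = (\<Sum>i<N. \<Sum>j<N.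
      v $ i * v $ j * (basis_vec m h u $ i * basis_vec m h u $ j * weight \<D> t h u))" for u
  proof -
    have "(\<Sum>k<N. v $ k * basis_vec m h u $ k)\<^sup>2 = (\<Sum>i<N. \<Sum>j<N.
        (v $ i * basis_vec m h u $ i) * (v $ j * basis_vec m h u $ j))"
      by (simp only: power2_eq_square sum_product)
    then show ?thesis
      unfolding v_basis by (simp only: sum_distrib_right) (simp add: mult_ac)
  qed
  show "integrable lborel (\<lambda>u. (v \<bullet> basis_vec m h u)\<^sup>2 * weight \<D> t h u)"
    unfolding sq by (intro Bochner_Integration.integrable_sum integrable_mult_right) (auto intro: int)
  have "v \<bullet> (gram \<D> t m h *\<^sub>v v) = (\<Sum>i<N. v $ i * (\<Sum>j<N. gram \<D> t m h $$ (i, j) * v $ j))"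
    using v unfolding N_def by (intro quadratic_form_sum) (auto simp: gram_def)
  also have "\<dots> = (\<Sum>i<N. \<Sum>j<N. v $ i * v $ j *
      (\<integral>u. basis_vec m h u $ i * basis_vec m h u $ j * weight \<D> t h u \<partial>lborel))"
    by (simp add: gram_def N_def[symmetric] sum_distrib_left mult_ac)
  also have "\<dots> = (\<integral>u. (v \<bullet> basis_vec m h u)\<^sup>2 * weight \<D> t h u \<partial>lborel)"
    unfolding sq
    by (subst Bochner_Integration.integral_sum,
        intro Bochner_Integration.integrable_sum integrable_mult_right int, simp_all,
        intro sum.cong refl, subst Bochner_Integration.integral_sum,
        intro integrable_mult_right int, simp_all)
  finally show "v \<bullet> (gram \<D> t m h *\<^sub>v v) =
    (\<integral>u. (v \<bullet> basis_vec m h u)\<^sup>2 * weight \<D> t h u \<partial>lborel)" .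
qed

text \<open>The set \<open>W\<close> in the proof is the part of the open cube around the origin that \<open>t\<close> translates into
  \<open>G\<close>. The weight is positive on it, and it is nonempty as \<open>t\<close> is in the closure of \<open>G\<close>.\<close>

lemma pos_def_gram:
  fixes \<D> G :: "(real ^ 'd::{finite,linorder}) set"
  assumes G: "open G" "\<D> = closure G" "t \<in> \<D>" and h: "0 < h"
  shows "pos_def_mat (num_monomials TYPE('d) m) (gram \<D> t m h)"
proof -
  define N where "N = num_monomials TYPE('d) m"
  have cl: "closed \<D>" using G(2) by simp
  have w0: "0 \<le> weight \<D> t h u" for u
    using h by (simp add: weight_eq_indicator)
  define W where "W = (\<Inter>j. {u. \<bar>vec_nth u j\<bar> < h}) \<inter> (\<lambda>u. t + u) -` G"
  have openW: "open W"
    unfolding W_def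
    by (intro open_Int open_INT open_vimage G open_Collect_less continuous_intros ballI) auto
  have "W \<noteq> {}"
  proof -
    define B where "B = (\<Inter>j. {x. \<bar>vec_nth x j - vec_nth t j\<bar> < h})"
    have "open B"
      unfolding B_def by (intro open_INT open_Collect_less continuous_intros ballI) auto
    moreover have "t \<in> B" using h by (simp add: B_def)
    ultimately have "B \<inter> G \<noteq> {}"
      using G(2,3) open_Int_closure_eq_empty[of B G] by auto
    then obtain x where "x \<in> B" "x \<in> G" by blast
    then have "x - t \<in> W" by (simp add: W_def B_def)
    then show ?thesis by blast
  qed
  have wW: "0 < weight \<D> t h u" if "u \<in> W" for u
    using that h closure_subset[of G]
    by (auto simp: weight_eq_indicator weight_support_def W_def G(2) less_imp_le)
  have "0 < v \<bullet> (gram \<D> t m h *\<^sub>v v)" if v: "v \<in> carrier_vec N" "v \<noteq> 0\<^sub>v N" for v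
  proof -
    define P where "P u = v \<bullet> basis_vec m h u" for u :: "real ^ 'd::_"
    have contP: "continuous_on UNIV P"
    proof -
      have "P = (\<lambda>u. \<Sum>k<N. v $ k * basis_vec m h u $ k)"
        by (simp add: fun_eq_iff P_def scalar_prod_def basis_vec_def lessThan_atLeast0 N_def)
      then show ?thesis
        by (auto intro!: continuous_intros continuous_on_basis_vec simp: N_def)
    qed
    note q = gram_quadratic_form[OF cl h v(1)[unfolded N_def], of t, folded P_def]
    have "(\<integral>u. (P u)\<^sup>2 * weight \<D> t h u \<partial>lborel) \<noteq> 0"
    proof
      assume "(\<integral>u. (P u)\<^sup>2 * weight \<D> t h u \<partial>lborel) = 0"
      moreover have "AE u in lborel. 0 \<le> (P u)\<^sup>2 * weight \<D> t h u"
        using w0 by simp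
      ultimately have "AE u in lborel. (P u)\<^sup>2 * weight \<D> t h u = 0"
        using integral_nonneg_eq_0_iff_AE[OF q(1)] by simp
      then have ae: "AE u in lborel. u \<notin> W \<inter> {u. P u \<noteq> 0}"
        by eventually_elim (use wW in fastforce)
      have "open (W \<inter> {u. P u \<noteq> 0})"
        by (intro open_Int openW open_Collect_neq contP continuous_on_const)
      moreover have "W \<inter> {u. P u \<noteq> 0} \<in> null_sets lborel"
        using ae calculation by (intro AE_iff_null_sets[THEN iffD2]) auto
      then have "negligible (W \<inter> {u. P u \<noteq> 0})"
        by (simp add: negligible_iff_null_sets null_sets_completionI)
      ultimately have "W \<inter> {u. P u \<noteq> 0} = {}"
        using open_not_negligible by blast
      then have "v = 0\<^sub>v N"
        unfolding N_def
        by (intro monomials_independent[OF h openW \<open>W \<noteq> {}\<close>]) (use v in \<open>auto simp: P_def N_def\<close>)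
      with v(2) show False ..
    qed
    moreover have "0 \<le> (\<integral>u. (P u)\<^sup>2 * weight \<D> t h u \<partial>lborel)"
      using w0 by (intro integral_nonneg_AE) auto
    ultimately show ?thesis using q(2) by simp
  qed
  moreover have "transpose_mat (gram \<D> t m h) = gram \<D> t m h"
    by (rule eq_matI) (auto simp: gram_def mult_ac)
  ultimately show ?thesis
    by (auto simp: pos_def_mat_def gram_def N_def)
qed

section \<open>Variance of a mean of independent variables\<close>

lemma (in prob_space) variance_sum_indep:
  fixes Y :: "'i \<Rightarrow> 'a \<Rightarrow> real"
  assumes I: "finite I" and ind: "indep_vars (\<lambda>_. borel) Y I"
    and sq: "\<And>i. i \<in> I \<Longrightarrow> integrable M (\<lambda>\<omega>. (Y i \<omega>)\<^sup>2)"
  shows "variance (\<lambda>\<omega>. \<Sum>i\<in>I. Y i \<omega>) = (\<Sum>i\<in>I. variance (Y i))"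
proof -
  have meas: "Y i \<in> borel_measurable M" if "i \<in> I" for i
    using ind that by (auto simp: indep_vars_def)
  have int: "integrable M (Y i)" if "i \<in> I" for i
    using square_integrable_imp_integrable[OF meas[OF that] sq[OF that]] .
  define Z where "Z i \<omega> = Y i \<omega> - expectation (Y i)" for i \<omega>
  have intZ: "integrable M (Z i)" if "i \<in> I" for i
    using int[OF that] by (simp add: Z_def[abs_def])
  have EZ: "expectation (Z i) = 0" if "i \<in> I" for i
    using int[OF that] by (simp add: Z_def[abs_def] prob_space)
  have indZ: "indep_vars (\<lambda>_. borel) Z I"
    unfolding Z_def[abs_def]
    by (rule indep_vars_compose2[OF ind, where Y = "\<lambda>i y. y - expectation (Y i)"]) measurable
  have cross: "integrable M (\<lambda>\<omega>. Z i \<omega> * Z j \<omega>) \<and> (i \<noteq> j \<longrightarrow> expectation (\<lambda>\<omega>. Z i \<omega> * Z j \<omega>) = 0)"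
    if ij: "i \<in> I" "j \<in> I" for i j
  proof (cases "i = j")
    case True
    have "integrable M (\<lambda>\<omega>. (Y i \<omega>)\<^sup>2 - 2 * expectation (Y i) * Y i \<omega> + (expectation (Y i))\<^sup>2)"
      using sq[OF ij(1)] int[OF ij(1)] by simp
    then show ?thesis
      using True by (simp add: Z_def power2_eq_square algebra_simps)
  next
    case False
    have ind2: "indep_vars (\<lambda>_. borel) Z {i, j}"
      using indep_vars_subset[OF indZ] ij by simp
    have "integrable M (\<lambda>\<omega>. \<Prod>k\<in>{i, j}. Z k \<omega>)"
      by (rule indep_vars_integrable[OF _ ind2]) (use intZ ij in auto)
    moreover have "expectation (\<lambda>\<omega>. \<Prod>k\<in>{i, j}. Z k \<omega>) = (\<Prod>k\<in>{i, j}. expectation (Z k))"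
      by (rule indep_vars_lebesgue_integral[OF _ ind2]) (use intZ ij in auto)
    ultimately show ?thesis
      using False EZ ij by simp
  qed
  have "variance (\<lambda>\<omega>. \<Sum>i\<in>I. Y i \<omega>) = expectation (\<lambda>\<omega>. \<Sum>i\<in>I. \<Sum>j\<in>I. Z i \<omega> * Z j \<omega>)"
    using int by (simp add: Z_def power2_eq_square sum_product flip: sum_subtractf)
  also have "\<dots> = (\<Sum>i\<in>I. \<Sum>j\<in>I. expectation (\<lambda>\<omega>. Z i \<omega> * Z j \<omega>))"
    using cross by simp
  also have "\<dots> = (\<Sum>i\<in>I. \<Sum>j\<in>I. if j = i then variance (Y i) else 0)"
    using cross by (intro sum.cong refl) (auto simp: Z_def power2_eq_square)
  also have "\<dots> = (\<Sum>i\<in>I. variance (Y i))"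
    using I by (simp add: sum.delta)
  finally show ?thesis .
qed

lemma (in prob_space) variance_cmult:
  "variance (\<lambda>\<omega>. c * Y \<omega>) = c\<^sup>2 * variance (Y :: 'a \<Rightarrow> real)"
proof -
  have "(c * Y \<omega> - c * expectation Y)\<^sup>2 = c\<^sup>2 * (Y \<omega> - expectation Y)\<^sup>2" for \<omega>
    by (simp add: power_mult_distrib flip: right_diff_distrib)
  then show ?thesis by simp
qed

lemma (in prob_space) variance_mean_le:
  fixes Y :: "'i \<Rightarrow> 'a \<Rightarrow> real"
  assumes I: "finite I" "I \<noteq> {}" and ind: "indep_vars (\<lambda>_. borel) Y I"
    and sq: "\<And>i. i \<in> I \<Longrightarrow> integrable M (\<lambda>\<omega>. (Y i \<omega>)\<^sup>2)"
    and v: "\<And>i. i \<in> I \<Longrightarrow> expectation (\<lambda>\<omega>. (Y i \<omega>)\<^sup>2) = v"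
  shows "variance (\<lambda>\<omega>. 1 / card I * (\<Sum>i\<in>I. Y i \<omega>)) \<le> v / card I"
proof -
  have "variance (Y i) \<le> v" if "i \<in> I" for i
  proof -
    have "Y i \<in> borel_measurable M"
      using ind that by (auto simp: indep_vars_def)
    then have "integrable M (Y i)"
      by (rule square_integrable_imp_integrable[OF _ sq[OF that]])
    then show ?thesis
      using variance_eq[OF _ sq[OF that]] v[OF that] by simp
  qed
  then have "(\<Sum>i\<in>I. variance (Y i)) \<le> card I * v"
    by (rule sum_bounded_above)
  then have "(1 / card I)\<^sup>2 * (\<Sum>i\<in>I. variance (Y i)) \<le> (1 / card I)\<^sup>2 * (card I * v)"
    by (intro mult_left_mono) auto
  also have "\<dots> = v / card I"
    using I by (simp add: power2_eq_square)
  also have "(1 / card I)\<^sup>2 * (\<Sum>i\<in>I. variance (Y i)) =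
      (1 / card I)\<^sup>2 * variance (\<lambda>\<omega>. \<Sum>i\<in>I. Y i \<omega>)"
    by (subst variance_sum_indep[OF I(1) ind sq]) auto
  also have "\<dots> = variance (\<lambda>\<omega>. 1 / card I * (\<Sum>i\<in>I. Y i \<omega>))"
    by (rule variance_cmult[symmetric])
  finally show ?thesis .
qed

section \<open>The kernel and its second moment\<close>

lemma infnorm_le_cart:
  assumes "\<And>j. \<bar>vec_nth u j\<bar> \<le> h"
  shows "infnorm (u :: real ^ 'd) \<le> h"
  unfolding infnorm_cart using assms by (intro cSup_least) auto

lemma borel_measurable_weight:
  assumes "closed \<D>" "0 < h"
  shows "weight \<D> t h \<in> borel_measurable borel"
proof -
  have [measurable]: "weight_support \<D> t h \<in> sets borel"
    by (intro borel_closed compact_imp_closed compact_weight_support assms(1))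
  then show ?thesis
    unfolding weight_eq_indicator[OF assms(2), abs_def] by measurable
qed

lemma borel_measurable_lp_kernel:
  fixes \<D> :: "(real ^ 'd::{finite,linorder}) set"
  assumes pd: "pos_def_mat (num_monomials TYPE('d) m) (gram \<D> t m h)"
    and "closed \<D>" "0 < h"
  shows "lp_kernel \<D> t m h \<in> borel_measurable borel"
proof -
  define N where "N = num_monomials TYPE('d) m"
  define B where "B = the (mat_inverse (cholesky (gram \<D> t m h)))"
  have B: "B \<in> carrier_mat N N"
    using cholesky_factor_inverse[OF is_cholesky_factor_cholesky[OF pd]] by (simp add: B_def N_def)
  \<comment> \<open>The kernel is \<open>(w \<bullet> basis_vec m h u) * weight \<D> t h u\<close> for a fixed vector \<open>w\<close>.\<close>
  define w where "w = transpose_mat B *\<^sub>v (B *\<^sub>v basis_vec m h (0 :: real ^ 'd::_))"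
  have "lp_kernel \<D> t m h = (\<lambda>u. (\<Sum>k<N. w $ k * basis_vec m h u $ k) * weight \<D> t h u)"
  proof
    fix u :: "real ^ 'd::_"
    have "B *\<^sub>v basis_vec m h (0 :: real ^ 'd::_) \<in> carrier_vec N"
      using B dim_basis_vec[of m h "0 :: real ^ 'd::_"] unfolding N_def by simp
    then have "(B *\<^sub>v basis_vec m h (0 :: real ^ 'd::_)) \<bullet> (B *\<^sub>v basis_vec m h u) = w \<bullet> basis_vec m h u"
      unfolding w_def using B by (intro transpose_vec_mult_scalar[symmetric]) (auto simp: N_def)
    also have "\<dots> = (\<Sum>k<N. w $ k * basis_vec m h u $ k)"
      by (simp add: scalar_prod_def basis_vec_def lessThan_atLeast0 N_def)
    finally show "lp_kernel \<D> t m h u = (\<Sum>k<N. w $ k * basis_vec m h u $ k) * weight \<D> t h u"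
      by (simp add: lp_kernel_def orth_basis_vec_def B_def)
  qed
  moreover have "(\<lambda>u :: real ^ 'd::_. \<Sum>k<N. w $ k * basis_vec m h u $ k) \<in> borel_measurable borel"
    by (intro borel_measurable_continuous_onI)
      (auto intro!: continuous_intros continuous_on_basis_vec simp: N_def)
  ultimately show ?thesis
    using borel_measurable_weight[OF assms(2,3), of t] by (simp add: borel_measurable_times)
qed

text \<open>One of the two factors \<open>h\<^sup>-\<^sup>d\<close> of the squared weight is kept as a weight.\<close>

lemma lp_kernel_square_le:
  fixes \<D> :: "(real ^ 'd::{finite,linorder}) set"
  assumes pd: "pos_def_mat (num_monomials TYPE('d) m) (gram \<D> t m h)" and h: "0 < h"
  shows "(lp_kernel \<D> t m h u)\<^sup>2 \<le>
    num_monomials TYPE('d) m / (min_eigenvalue (gram \<D> t m h))\<^sup>2 / h ^ CARD('d) * weight \<D> t h u"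
proof (cases "u \<in> weight_support \<D> t h")
  case False
  then show ?thesis
    using h by (simp add: lp_kernel_def weight_eq_indicator)
next
  case True
  let ?N = "num_monomials TYPE('d) m" and ?l = "min_eigenvalue (gram \<D> t m h)"
  have "(orth_basis_vec \<D> t m h 0 \<bullet> orth_basis_vec \<D> t m h u)\<^sup>2 \<le>
      (basis_vec m h (0 :: real ^ 'd::_) \<bullet> basis_vec m h (0 :: real ^ 'd::_)) *
        (basis_vec m h u \<bullet> basis_vec m h u) / ?l\<^sup>2"
    unfolding orth_basis_vec_def
    by (rule inverse_cholesky_scalar_prod_bound[OF pd num_monomials_pos]) auto
  also have "\<dots> \<le> ?N / ?l\<^sup>2"
    using True h by (auto simp: basis_vec_0_norm weight_support_def
        intro!: divide_right_mono basis_vec_norm_le)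
  finally have "(orth_basis_vec \<D> t m h 0 \<bullet> orth_basis_vec \<D> t m h u)\<^sup>2 * (inverse (h ^ CARD('d)))\<^sup>2 \<le>
      ?N / ?l\<^sup>2 * (inverse (h ^ CARD('d)))\<^sup>2"
    by (rule mult_right_mono) simp
  then show ?thesis
    using True h by (simp add: lp_kernel_def weight_eq_indicator power_mult_distrib)
      (simp add: power2_eq_square divide_inverse mult_ac)
qed

lemma lborel_translate:
  fixes g :: "real ^ 'd \<Rightarrow> real"
  assumes "g \<in> borel_measurable borel"
  shows lborel_integrable_translate: "integrable lborel (\<lambda>x. g (x - t)) \<longleftrightarrow> integrable lborel g"
    and lborel_integral_translate: "(\<integral>x. g (x - t) \<partial>lborel) = (\<integral>u. g u \<partial>lborel)"
proof -
  have "integrable lborel g \<longleftrightarrow> integrable (distr lborel borel ((+) (- t))) g"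
    by (simp add: lborel_distr_plus)
  also have "\<dots> \<longleftrightarrow> integrable lborel (\<lambda>x. g (- t + x))"
    using assms by (intro integrable_distr_eq) auto
  finally show "integrable lborel (\<lambda>x. g (x - t)) \<longleftrightarrow> integrable lborel g" by simp

  have "(\<integral>u. g u \<partial>lborel) = (\<integral>u. g u \<partial>distr lborel borel ((+) (- t)))"
    by (simp add: lborel_distr_plus)
  also have "\<dots> = (\<integral>x. g (- t + x) \<partial>lborel)"
    using assms by (intro integral_distr) auto
  finally show "(\<integral>x. g (x - t) \<partial>lborel) = (\<integral>u. g u \<partial>lborel)" by simp
qed

lemma second_moment_lp_kernel_le:
  fixes \<D> :: "(real ^ 'd::{finite,linorder}) set"
  assumes pd: "pos_def_mat (num_monomials TYPE('d) m) (gram \<D> t m h)"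
    and cl: "closed \<D>" and h: "0 < h" "h \<le> \<rho>"
    and f: "\<And>x. x \<in> \<D> \<Longrightarrow> 0 \<le> f x"
    and dist: "distributed M lborel X (\<lambda>x. ennreal (f x * indicator \<D> x))"
    and bdd: "bdd_above ((\<lambda>u. \<bar>f (t + u)\<bar>) ` nbhd \<D> t \<rho>)"
  shows "(\<integral>\<omega>. (lp_kernel \<D> t m h (X \<omega> - t))\<^sup>2 \<partial>M) \<le>
    num_monomials TYPE('d) m / (min_eigenvalue (gram \<D> t m h))\<^sup>2 / h ^ CARD('d) *
      sup_norm_nbhd \<D> t \<rho> f * total_weight \<D> t h"
proof -
  define C where
    "C = num_monomials TYPE('d) m / (min_eigenvalue (gram \<D> t m h))\<^sup>2 / h ^ CARD('d)"
  define s where "s = sup_norm_nbhd \<D> t \<rho> f"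
  have [measurable]: "lp_kernel \<D> t m h \<in> borel_measurable borel"
    "weight \<D> t h \<in> borel_measurable borel"
    using borel_measurable_lp_kernel[OF pd cl h(1)] borel_measurable_weight[OF cl h(1)] by auto
  have f0: "0 \<le> f x * indicator \<D> x" for x
    using f by (simp add: indicator_def)
  have bound: "f x * indicator \<D> x * (lp_kernel \<D> t m h (x - t))\<^sup>2 \<le> C * s * weight \<D> t h (x - t)" for x
  proof (cases "x - t \<in> weight_support \<D> t h")
    case False
    then show ?thesis
      using h by (simp add: lp_kernel_def weight_eq_indicator)
  next
    case True
    have "infnorm (x - t) \<le> h"
      using True by (intro infnorm_le_cart) (simp add: weight_support_def)
    then have "x - t \<in> nbhd \<D> t \<rho>"
      using True h by (simp add: nbhd_def weight_support_def)
    then have "\<bar>f (t + (x - t))\<bar> \<le> s"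
      unfolding s_def sup_norm_nbhd_def by (rule cSUP_upper[OF _ bdd])
    then have "f x * indicator \<D> x \<le> s"
      using True by (simp add: weight_support_def)
    then have "f x * indicator \<D> x * (lp_kernel \<D> t m h (x - t))\<^sup>2 \<le> s * (C * weight \<D> t h (x - t))"
      unfolding C_def using f0[of x] by (intro mult_mono lp_kernel_square_le[OF pd h(1)]) auto
    then show ?thesis by (simp add: mult_ac)
  qed
  have "integrable lborel (\<lambda>u. C * s * weight \<D> t h u)"
    using integrable_mult_weight[OF cl h(1), of "\<lambda>_. C * s"] by simp
  then have int: "integrable lborel (\<lambda>x. C * s * weight \<D> t h (x - t))"
    by (subst lborel_integrable_translate) auto
  have "(\<integral>\<omega>. (lp_kernel \<D> t m h (X \<omega> - t))\<^sup>2 \<partial>M) =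
      (\<integral>x. f x * indicator \<D> x * (lp_kernel \<D> t m h (x - t))\<^sup>2 \<partial>lborel)"
    by (rule distributed_integral[OF dist, symmetric]) (use f0 in auto)
  also have "\<dots> \<le> (\<integral>x. C * s * weight \<D> t h (x - t) \<partial>lborel)"
    using bound f0 by (intro integral_mono' int) (auto intro: order_trans[OF _ bound])
  also have "\<dots> = C * s * total_weight \<D> t h"
    by (simp add: total_weight_def lborel_integral_translate)
  finally show ?thesis by (simp add: C_def s_def)
qed

section \<open>The variance of the local polynomial estimator\<close>

theorem proposition4p2:
  fixes \<D> G :: "(real ^ 'd::{finite,linorder}) set"
    and t :: "real ^ 'd::_"
    and \<rho> h :: real
    and m n :: nat
    and f :: "real ^ 'd::_ \<Rightarrow> real"
    and M :: "'a measure"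
    and X :: "nat \<Rightarrow> 'a \<Rightarrow> real ^ 'd::_" \<comment> \<open>\<open>X 0\<close> is the generic variable, \<open>X 1, \<dots>, X n\<close> the sample\<close>
  assumes "open G" "G \<noteq> {}" "\<D> = closure G" "t \<in> \<D>"
    and "\<rho> \<in> {0<..exp (-1)}"
    and "\<exists>U. openin (top_of_set ((\<lambda>x. x - t) ` \<D>)) U \<and> 0 \<in> U \<and> U \<subseteq> nbhd \<D> t \<rho>"
    and "h \<in> {0<..\<rho>}"
    and "1 \<le> n"
    and "prob_space M"
    and "prob_space.indep_vars M (\<lambda>_. borel) X {0..n}"
    and "\<And>x. x \<in> \<D> \<Longrightarrow> 0 \<le> f x"
    and "\<And>i. i \<in> {0..n} \<Longrightarrow> distributed M lborel (X i) (\<lambda>x. ennreal (f x * indicator \<D> x))"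
    and "bdd_above ((\<lambda>u. \<bar>f (t + u)\<bar>) ` nbhd \<D> t \<rho>)"
  shows "prob_space.variance M (\<lambda>\<omega>. lp_estimator \<D> t m h n (\<lambda>i. X i \<omega>)) \<le> lp_v M (X 0) \<D> t m h n
    \<and> lp_v M (X 0) \<D> t m h n \<le> lp_v_star \<D> t \<rho> f m h n"
proof
  interpret prob_space M by fact
  have cl: "closed \<D>" and h: "0 < h" "h \<le> \<rho>"
    using assms(3,7) by auto
  have pd: "pos_def_mat (num_monomials TYPE('d) m) (gram \<D> t m h)"
    by (rule pos_def_gram[OF assms(1,3,4) h(1)])
  define Y where "Y i \<omega> = lp_kernel \<D> t m h (X i \<omega> - t)" for i \<omega>
  define v where "v = expectation (\<lambda>\<omega>. (Y 0 \<omega>)\<^sup>2)"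
  define C where
    "C = num_monomials TYPE('d) m / (min_eigenvalue (gram \<D> t m h))\<^sup>2 / h ^ CARD('d)"
  have C: "0 \<le> C" using h by (simp add: C_def)
  note [measurable] = borel_measurable_lp_kernel[OF pd cl h(1)]
  have [measurable]: "X i \<in> measurable M borel" if "i \<in> {0..n}" for i
    using assms(10) that by (auto simp: indep_vars_def)
  have sq: "integrable M (\<lambda>\<omega>. (Y i \<omega>)\<^sup>2)" if i: "i \<in> {0..n}" for i
  proof (rule integrable_const_bound)
    have "(Y i \<omega>)\<^sup>2 \<le> C * inverse (h ^ CARD('d))" for \<omega>
    proof -
      have "(Y i \<omega>)\<^sup>2 \<le> C * weight \<D> t h (X i \<omega> - t)"
        unfolding Y_def C_def by (rule lp_kernel_square_le[OF pd h(1)])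
      also have "\<dots> \<le> C * inverse (h ^ CARD('d))"
        using C h by (intro mult_left_mono) (auto simp: weight_eq_indicator indicator_def)
      finally show ?thesis .
    qed
    then show "AE \<omega> in M. norm ((Y i \<omega>)\<^sup>2) \<le> C * inverse (h ^ CARD('d))" by simp
    show "(\<lambda>\<omega>. (Y i \<omega>)\<^sup>2) \<in> borel_measurable M"
      unfolding Y_def using i by measurable
  qed
  have same: "expectation (\<lambda>\<omega>. (Y i \<omega>)\<^sup>2) = v" if "i \<in> {0..n}" for i
  proof -
    have "expectation (\<lambda>\<omega>. (Y i \<omega>)\<^sup>2) =
        (\<integral>x. f x * indicator \<D> x * (lp_kernel \<D> t m h (x - t))\<^sup>2 \<partial>lborel)" if "i \<in> {0..n}" for i
      unfolding Y_def using assms(11)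
      by (intro distributed_integral[OF assms(12)[OF that], symmetric]) (auto simp: indicator_def)
    from this[OF that] this[of 0] show ?thesis by (simp add: v_def)
  qed
  have ind: "indep_vars (\<lambda>_. borel) Y {1..n}"
    unfolding Y_def
    by (rule indep_vars_compose2[OF indep_vars_subset[OF assms(10)],
          where Y = "\<lambda>_ x. lp_kernel \<D> t m h (x - t)"]) auto
  have "variance (\<lambda>\<omega>. 1 / card {1..n} * (\<Sum>i\<in>{1..n}. Y i \<omega>)) \<le> v / card {1..n}"
    using assms(8) by (intro variance_mean_le ind sq same) auto
  then show "variance (\<lambda>\<omega>. lp_estimator \<D> t m h n (\<lambda>i. X i \<omega>)) \<le> lp_v M (X 0) \<D> t m h n"
    by (simp add: lp_estimator_def lp_v_def Y_def v_def)
  have "v \<le> C * sup_norm_nbhd \<D> t \<rho> f * total_weight \<D> t h"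
    unfolding v_def Y_def C_def
    by (rule second_moment_lp_kernel_le[OF pd cl h assms(11) assms(12) assms(13)]) auto
  then have "v / n \<le> C * sup_norm_nbhd \<D> t \<rho> f * total_weight \<D> t h / n"
    by (rule divide_right_mono) simp
  also have "\<dots> = lp_v_star \<D> t \<rho> f m h n"
    using h assms(8)
    \<comment> \<open>If the total weight is \<open>0\<close>, both sides are \<open>0\<close>.\<close>
    by (cases "total_weight \<D> t h = 0")
      (simp_all add: lp_v_star_def C_def power_divide power_mult_distrib, simp add: power2_eq_square mult_ac)
  finally show "lp_v M (X 0) \<D> t m h n \<le> lp_v_star \<D> t \<rho> f m h n"
    by (simp add: lp_v_def v_def Y_def)
qed

end
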